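(* Let $\mathfrak{A}=(A;\vee,\wedge,\odot,\rightarrow,0,1)$ be a residuated lattice. The following assertions are equivalent: (1) for any $F,G\in\Omega(\mathfrak{A})$, $F\vee^{\omega}G=A$ implies $F\veebar G=A$; (2) $\mathfrak{A}$ is mp; (3) for any $\mathcal{F}\subseteq\Omega(\mathfrak{A})$, $\veebar\mathcal{F}\in\Omega(\mathfrak{A})$; (4) $(\Omega(\mathfrak{A});\cap,\veebar)$ is a frame; (5) $(\gamma(\mathfrak{A});\cap,\veebar)$ is a lattice.
   Context: A residuated lattice is an algebra $\mathfrak{A}=(A;\vee,\wedge,\odot,\rightarrow,0,1)$ such that $\ell(\mathfrak{A})=(A;\vee,\wedge,0,1)$ is a bounded lattice, $(A;\odot,1)$ is a commutative monoid, and $x\odot y\leq z$ iff $x\leq y\rightarrow z$ for all $x,y,z\in A$. A filter of $\mathfrak{A}$ is a non-empty subset $F\subseteq A$ with $x\odot y\in F$ for all $x,y\in F$, and $x\vee y\in F$ for all $x\in F$, $y\in A$. For a set $\mathcal{F}$ of filters, $\veebar\mathcal{F}$ is the filter generated by $\bigcup\mathcal{F}$, and $F\veebar G=\veebar\{F,G\}$. A prime filter is a proper filter that is meet-irreducible among filters (equivalently, $x\vee y\in\mathfrak{p}$ implies $x\in\mathfrak{p}$ or $y\in\mathfrak{p}$); a minimal prime filter is an inclusion-minimal prime filter. $\mathfrak{A}$ is mp if every prime filter contains a unique minimal prime filter. An ideal of the lattice $\ell(\mathfrak{A})$ is a non-empty, downward closed subset closed under $\vee$ ($A$ itself is allowed).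 For an ideal $I$ put $\omega(I)=\{a\in A\mid a\vee x=1\text{ for some }x\in I\}$; this is a filter. $\Omega(\mathfrak{A})=\{\omega(I)\mid I\text{ an ideal of }\ell(\mathfrak{A})\}$. For $F=\omega(I_F)$ and $G=\omega(I_G)$ in $\Omega(\mathfrak{A})$, $F\vee^{\omega}G=\omega(I_F\curlyvee I_G)$, where $\curlyvee$ is the join in the lattice of ideals of $\ell(\mathfrak{A})$ (this does not depend on the choice of $I_F,I_G$, and $\Omega(\mathfrak{A})$ is a bounded distributive lattice under $\cap$ and $\vee^{\omega}$). For $x\in A$, $x^{\perp}=\{a\in A\mid a\vee x=1\}$, and $\gamma(\mathfrak{A})=\{x^{\perp}\mid x\in A\}$. A frame is a lattice in which arbitrary joins exist and $a\wedge\bigvee S=\bigvee\{a\wedge s\mid s\in S\}$ for all elements $a$ and subsets $S$. Statement (4) means that $\Omega(\mathfrak{A})$, with binary intersection as meet and with $\veebar$ (of arbitrary families) as join, is a frame (in particular it is closed under these operations); statement (5) means that $\gamma(\mathfrak{A})$ is closed under the binary operations $\cap$ and $\veebar$ and is a lattice under them. *)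

theory Defs
  imports Main
begin

section \<open>Residuated lattices\<close>

text \<open>
  The monoid operation is written \<open>*\<close> and its unit \<open>1\<close>; the lattice bounds are \<open>bot\<close> and \<open>top\<close>,
  and the unit is required to be \<open>top\<close>. The algebra is the whole type, so its carrier is \<open>UNIV\<close>.
  The one-element algebra is not excluded.
\<close>

class residuated_lattice = bounded_lattice + comm_monoid_mult +
  fixes residuum :: "'a \<Rightarrow> 'a \<Rightarrow> 'a"  (infixr "\<rightarrow>" 60)
  assumes one_eq_top: "1 = top"
    and residuation: "x * y \<le> z \<longleftrightarrow> x \<le> y \<rightarrow> z"


section \<open>Filters\<close>

definition rl_filter :: "'a::residuated_lattice set \<Rightarrow> bool" where
  "rl_filter F \<longleftrightarrow> F \<noteq> {} \<and> (\<forall>x\<in>F. \<forall>y\<in>F. x * y \<in> F) \<and> (\<forall>x\<in>F. \<forall>y. sup x y \<in> F)"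

definition filter_generated :: "'a::residuated_lattice set \<Rightarrow> 'a set" where
  "filter_generated X = \<Inter>{F. rl_filter F \<and> X \<subseteq> F}"

definition filter_Join :: "'a::residuated_lattice set set \<Rightarrow> 'a set" where
  "filter_Join \<F> = filter_generated (\<Union>\<F>)"

definition filter_join :: "'a::residuated_lattice set \<Rightarrow> 'a set \<Rightarrow> 'a set" where
  "filter_join F G = filter_Join {F, G}"

definition prime_filter :: "'a::residuated_lattice set \<Rightarrow> bool" where
  "prime_filter P \<longleftrightarrow> rl_filter P \<and> P \<noteq> UNIV \<and>
     (\<forall>F G. rl_filter F \<longrightarrow> rl_filter G \<longrightarrow> P = F \<inter> G \<longrightarrow> P = F \<or> P = G)"

definition minimal_prime_filter :: "'a::residuated_lattice set \<Rightarrow> bool" where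
  "minimal_prime_filter P \<longleftrightarrow> prime_filter P \<and> (\<forall>Q. prime_filter Q \<longrightarrow> Q \<subseteq> P \<longrightarrow> Q = P)"

text \<open>A property of the algebra as a whole, hence the type argument.\<close>

definition is_mp :: "'a::residuated_lattice itself \<Rightarrow> bool" where
  "is_mp _ \<longleftrightarrow> (\<forall>P :: 'a set. prime_filter P \<longrightarrow> (\<exists>!M. minimal_prime_filter M \<and> M \<subseteq> P))"


section \<open>Ideals of the lattice reduct and the filters they induce\<close>

definition lattice_ideal :: "'a::lattice set \<Rightarrow> bool" where
  "lattice_ideal I \<longleftrightarrow> I \<noteq> {} \<and> (\<forall>x\<in>I. \<forall>y. y \<le> x \<longrightarrow> y \<in> I) \<and> (\<forall>x\<in>I. \<forall>y\<in>I. sup x y \<in> I)"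

text \<open>The join in the lattice of ideals: the least ideal containing both.\<close>

definition ideal_join :: "'a::lattice set \<Rightarrow> 'a set \<Rightarrow> 'a set" where
  "ideal_join I J = \<Inter>{K. lattice_ideal K \<and> I \<union> J \<subseteq> K}"

definition omega :: "'a::residuated_lattice set \<Rightarrow> 'a set" where
  "omega I = {a. \<exists>x\<in>I. sup a x = 1}"

definition Omega :: "'a::residuated_lattice set set" where
  "Omega = {omega I | I. lattice_ideal I}"

text \<open>
  The value is unspecified outside \<open>Omega\<close>; on \<open>Omega\<close> the description is well defined,
  see \<open>omega_join_omega\<close> below.
\<close>

definition omega_join :: "'a::residuated_lattice set \<Rightarrow> 'a set \<Rightarrow> 'a set" where
  "omega_join F G = (THE H. \<exists>I J. lattice_ideal I \<and> lattice_ideal J \<and>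
     F = omega I \<and> G = omega J \<and> H = omega (ideal_join I J))"

definition coannihilator :: "'a::residuated_lattice \<Rightarrow> 'a set" where
  "coannihilator x = {a. sup a x = 1}"

definition gamma :: "'a::residuated_lattice set set" where
  "gamma = range coannihilator"


section \<open>Lattices and frames on a carrier set\<close>

locale lattice_on =
  fixes L :: "'b set" and meet :: "'b \<Rightarrow> 'b \<Rightarrow> 'b" and join :: "'b \<Rightarrow> 'b \<Rightarrow> 'b"
  assumes meet_closed: "\<And>a b. a \<in> L \<Longrightarrow> b \<in> L \<Longrightarrow> meet a b \<in> L"
    and join_closed: "\<And>a b. a \<in> L \<Longrightarrow> b \<in> L \<Longrightarrow> join a b \<in> L"
    and meet_comm: "\<And>a b. a \<in> L \<Longrightarrow> b \<in> L \<Longrightarrow> meet a b = meet b a"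
    and join_comm: "\<And>a b. a \<in> L \<Longrightarrow> b \<in> L \<Longrightarrow> join a b = join b a"
    and meet_assoc: "\<And>a b c. a \<in> L \<Longrightarrow> b \<in> L \<Longrightarrow> c \<in> L \<Longrightarrow> meet (meet a b) c = meet a (meet b c)"
    and join_assoc: "\<And>a b c. a \<in> L \<Longrightarrow> b \<in> L \<Longrightarrow> c \<in> L \<Longrightarrow> join (join a b) c = join a (join b c)"
    and meet_join_absorb: "\<And>a b. a \<in> L \<Longrightarrow> b \<in> L \<Longrightarrow> meet a (join a b) = a"
    and join_meet_absorb: "\<And>a b. a \<in> L \<Longrightarrow> b \<in> L \<Longrightarrow> join a (meet a b) = a"

text \<open>
  The signature of a frame is a binary meet and a join of arbitrary subsets of the carrier; the
  binary join is the join of a pair. The order is \<open>a \<le> b \<longleftrightarrow> meet a b = a\<close>.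
\<close>

locale frame_on = lattice_on L meet "\<lambda>a b. Join {a, b}"
  for L :: "'b set" and meet :: "'b \<Rightarrow> 'b \<Rightarrow> 'b" and Join :: "'b set \<Rightarrow> 'b" +
  assumes Join_closed: "\<And>S. S \<subseteq> L \<Longrightarrow> Join S \<in> L"
    and Join_upper: "\<And>S s. S \<subseteq> L \<Longrightarrow> s \<in> S \<Longrightarrow> meet s (Join S) = s"
    and Join_least: "\<And>S u. S \<subseteq> L \<Longrightarrow> u \<in> L \<Longrightarrow> (\<And>s. s \<in> S \<Longrightarrow> meet s u = s) \<Longrightarrow> meet (Join S) u = Join S"
    and meet_Join_distrib: "\<And>a S. a \<in> L \<Longrightarrow> S \<subseteq> L \<Longrightarrow> meet a (Join S) = Join {meet a s | s. s \<in> S}"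


section \<open>Well-definedness\<close>

lemma rl_mult_mono_right:
  fixes x y z :: "'a::residuated_lattice"
  assumes "x \<le> y" shows "x * z \<le> y * z"
  using assms residuation order_trans order_refl by metis

lemma rl_le_one: "(x::'a::residuated_lattice) \<le> 1"
  by (simp add: one_eq_top)

lemma rl_mult_le_left: "(x::'a::residuated_lattice) * y \<le> x"
  using rl_mult_mono_right[OF rl_le_one, of y x] by (simp add: mult.commute)

lemma rl_sup_mult_one:
  fixes a b z :: "'a::residuated_lattice"
  assumes a: "sup a z = 1" and b: "sup b z = 1"
  shows "sup (a * b) z = 1"
proof -
  have "z \<le> b \<rightarrow> sup (a * b) z"
    using rl_mult_le_left[of z b] by (simp add: residuation[symmetric] le_supI2)
  moreover have "a \<le> b \<rightarrow> sup (a * b) z" by (simp add: residuation[symmetric])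
  ultimately have "1 \<le> b \<rightarrow> sup (a * b) z" using a by (metis sup.bounded_iff)
  then have "b \<le> sup (a * b) z" by (simp add: residuation[symmetric])
  then have "sup b z \<le> sup (a * b) z" by simp
  then show ?thesis using b by (metis antisym rl_le_one)
qed

lemma omega_filter:
  assumes "lattice_ideal I" shows "rl_filter (omega I)"
proof -
  have "\<exists>w\<in>I. sup (a * b) w = 1"
    if "x \<in> I" "y \<in> I" "sup a x = 1" "sup b y = 1" for a b x y
  proof (rule bexI)
    have "sup a (sup x y) = 1" "sup b (sup x y) = 1"
      using that by (metis one_eq_top sup_top_left sup_assoc sup_commute)+
    then show "sup (a * b) (sup x y) = 1" by (rule rl_sup_mult_one)
    show "sup x y \<in> I" using that assms by (simp add: lattice_ideal_def)
  qed
  moreover have "omega I \<noteq> {}"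
    using assms unfolding omega_def lattice_ideal_def
    by (metis (mono_tags, lifting) empty_Collect_eq ex_in_conv one_eq_top sup_top_left)
  moreover have "\<exists>w\<in>I. sup (sup a b) w = 1" if "x \<in> I" "sup a x = 1" for a b x
    using that by (metis one_eq_top sup_top_left sup_assoc sup_commute)
  ultimately show ?thesis unfolding rl_filter_def omega_def by blast
qed

lemma filter_generated_filter: "rl_filter (filter_generated X)"
proof -
  have "1 \<in> F" if F: "rl_filter F" for F :: "'a set"
  proof -
    obtain x where "x \<in> F" using F by (auto simp: rl_filter_def)
    then have "sup x 1 \<in> F" using F by (simp add: rl_filter_def)
    then show ?thesis by (simp add: one_eq_top)
  qed
  then have "1 \<in> filter_generated X" by (auto simp: filter_generated_def)
  moreover have "x * y \<in> filter_generated X"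
    if "x \<in> filter_generated X" "y \<in> filter_generated X" for x y
    using that by (auto simp: filter_generated_def rl_filter_def)
  moreover have "sup x y \<in> filter_generated X" if "x \<in> filter_generated X" for x y
    using that by (auto simp: filter_generated_def rl_filter_def)
  ultimately show ?thesis unfolding rl_filter_def by blast
qed

lemma ideal_join_eq:
  assumes I: "lattice_ideal I" and J: "lattice_ideal J"
  shows "ideal_join I J = {z. \<exists>x\<in>I. \<exists>y\<in>J. z \<le> sup x y}" (is "_ = ?K")
proof
  have "sup z z' \<in> ?K" if zz: "z \<in> ?K" "z' \<in> ?K" for z z'
  proof -
    obtain x y x' y' where *: "x \<in> I" "y \<in> J" "z \<le> sup x y" "x' \<in> I" "y' \<in> J" "z' \<le> sup x' y'"
      using zz by blast
    have "sup z z' \<le> sup (sup x y) (sup x' y')" using *(3,6) by (rule sup_mono)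
    also have "\<dots> = sup (sup x x') (sup y y')" by (simp add: ac_simps)
    finally show ?thesis using * I J unfolding lattice_ideal_def by blast
  qed
  moreover have sub: "I \<subseteq> ?K" "J \<subseteq> ?K"
  proof -
    obtain i j where "i \<in> I" "j \<in> J" using I J by (auto simp: lattice_ideal_def)
    then show "I \<subseteq> ?K" "J \<subseteq> ?K" using sup_ge1 sup_ge2 by blast+
  qed
  moreover have "y \<in> ?K" if "x \<in> ?K" "y \<le> x" for x y
    using that by (blast intro: order_trans)
  moreover have "?K \<noteq> {}" using sub I by (auto simp: lattice_ideal_def)
  ultimately have "lattice_ideal ?K" unfolding lattice_ideal_def by blast
  then show "ideal_join I J \<subseteq> ?K" unfolding ideal_join_def using sub by blast
next
  show "?K \<subseteq> ideal_join I J" unfolding ideal_join_def lattice_ideal_def by blast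
qed

lemma omega_ideal_join:
  assumes "lattice_ideal I" "lattice_ideal J"
  shows "omega (ideal_join I J) = {a. \<exists>x\<in>I. \<exists>y\<in>J. sup (sup a x) y = 1}"
proof -
  have "(\<exists>z. (\<exists>x\<in>I. \<exists>y\<in>J. z \<le> sup x y) \<and> sup a z = 1) \<longleftrightarrow>
        (\<exists>x\<in>I. \<exists>y\<in>J. sup (sup a x) y = 1)" for a :: 'a
  proof -
    have "sup (sup a x) y = 1" if "z \<le> sup x y" "sup a z = 1" for x y z
      using sup_mono[OF order_refl that(1), of a] that(2)
      by (simp add: sup_assoc antisym rl_le_one)
    then show ?thesis by (metis order_refl sup_assoc)
  qed
  then show ?thesis by (auto simp: omega_def ideal_join_eq[OF assms])
qed

lemma omega_join_omega:
  fixes I J :: "'a::residuated_lattice set"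
  assumes I: "lattice_ideal I" and J: "lattice_ideal J"
  shows "omega_join (omega I) (omega J) = omega (ideal_join I J)"
proof -
  have ex: "(\<exists>x\<in>I. \<exists>y\<in>J. sup (sup a x) y = 1) \<longleftrightarrow> (\<exists>y\<in>J. sup a y \<in> omega I)"
    for I J and a :: 'a
  proof -
    have "sup (sup a x) y = sup (sup a y) x" for x y by (simp add: ac_simps)
    then show ?thesis unfolding omega_def mem_Collect_eq by metis
  qed
  have ex': "(\<exists>x\<in>I. \<exists>y\<in>J. sup (sup a x) y = 1) \<longleftrightarrow> (\<exists>x\<in>I. sup a x \<in> omega J)"
    for I J and a :: 'a
    unfolding omega_def by auto
  have "omega (ideal_join I' J') = omega (ideal_join I J)"
    if "lattice_ideal I'" "lattice_ideal J'" "omega I = omega I'" "omega J = omega J'" for I' J'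
  proof -
    have "(\<exists>x\<in>I'. \<exists>y\<in>J'. sup (sup a x) y = 1) \<longleftrightarrow> (\<exists>x\<in>I. \<exists>y\<in>J. sup (sup a x) y = 1)" for a :: 'a
      using ex[of I' J' a] ex[of I J' a] ex'[of I J' a] ex'[of I J a] that by simp
    then show ?thesis by (simp add: omega_ideal_join I J that)
  qed
  then show ?thesis unfolding omega_join_def using I J by (intro the_equality) blast+
qed

end

theory Submission
  imports Defs
begin

text \<open>
  All five assertions are equivalent to one elementary condition on coannihilators
  (\<open>comaximal_coannihilators\<close>): if \<open>x \<squnion> y = 1\<close>, then \<open>x\<^sup>\<bottom>\<close> and \<open>y\<^sup>\<bottom>\<close> together generate
  the whole algebra. Here \<open>x\<^sup>\<bottom>\<close> denotes the coannihilator of \<open>x\<close>, which is also \<open>\<omega>\<close> of the principal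
  ideal of \<open>x\<close>, so that \<open>\<gamma> \<subseteq> \<Omega>\<close>.

  For (1), membership of \<open>0\<close> in \<open>\<omega>(I) \<or>\<^sup>\<omega> \<omega>(J)\<close> means exactly that \<open>x \<squnion> y = 1\<close> for some
  \<open>x \<in> I\<close> and \<open>y \<in> J\<close>, and \<open>x\<^sup>\<bottom> \<subseteq> \<omega>(I)\<close>, \<open>y\<^sup>\<bottom> \<subseteq> \<omega>(J)\<close>.

  For (2), the key is that a prime filter \<open>P\<close> contains \<open>x\<^sup>\<bottom>\<close> if and only if some prime filter below
  \<open>P\<close> omits \<open>x\<close>. If \<open>x\<^sup>\<bottom>\<close> and \<open>y\<^sup>\<bottom>\<close> lie in a common prime filter although \<open>x \<squnion> y = 1\<close>, there
  are minimal primes below it omitting \<open>x\<close> and \<open>y\<close> respectively; they differ, because a prime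
  cannot omit both. Conversely two distinct minimal primes below \<open>P\<close> are told apart by such a
  pair \<open>x\<close>, \<open>y\<close>, and then \<open>P\<close> contains both coannihilators.

  For (3), (4) and (5), the condition implies \<open>x\<^sup>\<bottom> \<veebar> y\<^sup>\<bottom> = (x \<squnion> y)\<^sup>\<bottom>\<close>. Therefore the elements
  whose coannihilator lies in a given filter form an ideal, and this ideal represents any join of
  members of \<open>\<Omega>\<close>. The remaining lattice and frame laws hold among all filters. In the other
  direction it is enough that \<open>x\<^sup>\<bottom> \<veebar> y\<^sup>\<bottom>\<close> lies in \<open>\<Omega>\<close>, as each of (3), (4), (5) ensures: a filter
  \<open>\<omega>(I)\<close> that contains \<open>x\<close>, \<open>y\<close> and everything in \<open>x\<^sup>\<bottom> \<inter> y\<^sup>\<bottom>\<close> must have \<open>1 \<in> I\<close>.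

  Generated filters are handled without explicit products of generators: the substitute is the
  fact that \<open>{b. a \<squnion> b \<in> F}\<close> is a filter whenever \<open>F\<close> is.
\<close>


section \<open>The lattice of filters\<close>

lemma rl_filter_mult: "rl_filter F \<Longrightarrow> x \<in> F \<Longrightarrow> y \<in> F \<Longrightarrow> x * y \<in> F"
  by (simp add: rl_filter_def)

lemma rl_filter_sup: "rl_filter F \<Longrightarrow> x \<in> F \<Longrightarrow> sup x y \<in> F"
  by (simp add: rl_filter_def)

lemma rl_filter_up: "rl_filter F \<Longrightarrow> x \<in> F \<Longrightarrow> x \<le> y \<Longrightarrow> y \<in> F"
  by (metis rl_filter_sup sup.absorb2)

lemma rl_filter_one: "rl_filter F \<Longrightarrow> 1 \<in> F"
  by (metis ex_in_conv rl_filter_def rl_filter_up rl_le_one)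

lemma rl_filter_UNIV_iff: "rl_filter F \<Longrightarrow> F = UNIV \<longleftrightarrow> bot \<in> F"
  by (metis UNIV_I UNIV_eq_I bot_least rl_filter_up)

lemma rl_filter_Inter:
  assumes "\<And>F. F \<in> C \<Longrightarrow> rl_filter F"
  shows "rl_filter (\<Inter>C)"
proof -
  have "1 \<in> \<Inter>C" using assms rl_filter_one by blast
  moreover have "x * y \<in> \<Inter>C" if "x \<in> \<Inter>C" "y \<in> \<Inter>C" for x y
    using assms that rl_filter_mult by blast
  moreover have "sup x y \<in> \<Inter>C" if "x \<in> \<Inter>C" for x y
    using assms that rl_filter_sup by blast
  ultimately show ?thesis unfolding rl_filter_def by blast
qed

lemma filter_generated_upper: "X \<subseteq> filter_generated X"
  by (auto simp: filter_generated_def)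

lemma filter_generated_least: "rl_filter H \<Longrightarrow> filter_generated X \<subseteq> H \<longleftrightarrow> X \<subseteq> H"
  by (auto simp: filter_generated_def)

lemma filter_Join_filter: "rl_filter (filter_Join \<F>)"
  by (simp add: filter_Join_def filter_generated_filter)

lemma filter_Join_subset_iff:
  "rl_filter H \<Longrightarrow> filter_Join \<F> \<subseteq> H \<longleftrightarrow> (\<forall>F\<in>\<F>. F \<subseteq> H)"
  by (auto simp: filter_Join_def filter_generated_least)

lemma filter_Join_upper: "F \<in> \<F> \<Longrightarrow> F \<subseteq> filter_Join \<F>"
  using filter_Join_subset_iff[OF filter_Join_filter] by blast

lemma filter_join_filter: "rl_filter (filter_join F G)"
  by (simp add: filter_join_def filter_Join_filter)

lemma filter_join_subset_iff:
  "rl_filter H \<Longrightarrow> filter_join F G \<subseteq> H \<longleftrightarrow> F \<subseteq> H \<and> G \<subseteq> H"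
  by (simp add: filter_join_def filter_Join_subset_iff)

lemma filter_join_upper: "F \<subseteq> filter_join F G" "G \<subseteq> filter_join F G"
  by (simp_all add: filter_join_def filter_Join_upper)

lemma sup_mult_sup_le:
  fixes a b c :: "'a::residuated_lattice"
  shows "sup a b * sup a c \<le> sup a (b * c)"
proof -
  have le: "u * v \<le> sup a (b * c)" if "u \<le> a" for u v
    using that rl_mult_le_left order_trans le_supI1 by metis
  have "a \<le> b \<rightarrow> sup a (b * c)" "c \<le> b \<rightarrow> sup a (b * c)"
    by (simp_all add: residuation[symmetric] le mult.commute[of c])
  then have "sup a c * b \<le> sup a (b * c)" by (simp add: residuation)
  then have "b \<le> sup a c \<rightarrow> sup a (b * c)" by (simp add: residuation[symmetric] mult.commute)
  moreover have "a \<le> sup a c \<rightarrow> sup a (b * c)" by (simp add: residuation[symmetric] le)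
  ultimately show ?thesis by (simp add: residuation)
qed

text \<open>
  This filter replaces an explicit description of generated filters: to show that \<open>a \<squnion> b\<close> lies in
  \<open>F\<close> for every \<open>b\<close> in a generated filter, it is enough to check the generators \<open>b\<close>.
\<close>

lemma rl_filter_colon:
  assumes F: "rl_filter F"
  shows "rl_filter {b. sup a b \<in> F}"
proof -
  have "sup a 1 \<in> F" using rl_filter_one[OF F] by (simp add: one_eq_top)
  moreover have "sup a (b * c) \<in> F" if "sup a b \<in> F" "sup a c \<in> F" for b c
    using rl_filter_up[OF F rl_filter_mult[OF F that] sup_mult_sup_le] .
  moreover have "sup a (sup b c) \<in> F" if "sup a b \<in> F" for b c
    using rl_filter_sup[OF F that, of c] by (simp add: sup_assoc)
  ultimately show ?thesis unfolding rl_filter_def by blast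
qed

text \<open>
  For \<open>a \<in> F\<close>, joining with \<open>a\<close> sends each \<open>G\<close> into \<open>F \<inter> G\<close>, hence sends the join of the family
  into the right-hand side; an \<open>a\<close> that also lies in that join is recovered as \<open>a \<squnion> a\<close>.
\<close>

lemma filter_Join_distrib:
  assumes F: "rl_filter F" and \<F>: "\<And>G. G \<in> \<F> \<Longrightarrow> rl_filter G"
  shows "F \<inter> filter_Join \<F> = filter_Join {F \<inter> G | G. G \<in> \<F>}" (is "_ = ?R")
proof
  show "F \<inter> filter_Join \<F> \<subseteq> ?R"
  proof
    fix a assume a: "a \<in> F \<inter> filter_Join \<F>"
    have "sup a b \<in> ?R" if "G \<in> \<F>" "b \<in> G" for G b
    proof -
      have "sup a b \<in> F \<inter> G"
        using rl_filter_sup[OF F, of a b] rl_filter_sup[OF \<F>[OF that(1)] that(2), of a] a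
        by (simp add: sup_commute)
      then show ?thesis using filter_Join_upper[of "F \<inter> G" "{F \<inter> G | G. G \<in> \<F>}"] that(1)
        by blast
    qed
    then have "filter_Join \<F> \<subseteq> {b. sup a b \<in> ?R}"
      by (subst filter_Join_subset_iff[OF rl_filter_colon[OF filter_Join_filter]]) blast
    then show "a \<in> ?R" using a by auto
  qed
  have "F \<inter> G \<subseteq> filter_Join \<F>" if "G \<in> \<F>" for G
    using filter_Join_upper[OF that] by blast
  then have "?R \<subseteq> filter_Join \<F>"
    by (subst filter_Join_subset_iff[OF filter_Join_filter]) blast
  moreover have "?R \<subseteq> F" by (subst filter_Join_subset_iff[OF F]) blast
  ultimately show "?R \<subseteq> F \<inter> filter_Join \<F>" by blast
qed

lemma lattice_on_filters:
  assumes filters: "\<And>F. F \<in> L \<Longrightarrow> rl_filter F"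
    and "\<And>F G. F \<in> L \<Longrightarrow> G \<in> L \<Longrightarrow> F \<inter> G \<in> L"
    and "\<And>F G. F \<in> L \<Longrightarrow> G \<in> L \<Longrightarrow> filter_join F G \<in> L"
  shows "lattice_on L (\<inter>) filter_join"
proof
  fix F G H assume F: "F \<in> L" and G: "G \<in> L" and H: "H \<in> L"
  show "filter_join (filter_join F G) H = filter_join F (filter_join G H)"
  proof (rule antisym)
    show "filter_join (filter_join F G) H \<subseteq> filter_join F (filter_join G H)"
      using filter_join_upper[where F = F and G = "filter_join G H"]
        filter_join_upper[where F = G and G = H]
      by (auto simp: filter_join_subset_iff filter_join_filter)
    show "filter_join F (filter_join G H) \<subseteq> filter_join (filter_join F G) H"
      using filter_join_upper[where F = "filter_join F G" and G = H]
        filter_join_upper[where F = F and G = G]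
      by (auto simp: filter_join_subset_iff filter_join_filter)
  qed
  show "filter_join F (F \<inter> G) = F"
    using filter_join_subset_iff[OF filters[OF F], of F "F \<inter> G"] filter_join_upper(1)[of F]
    by blast
  show "F \<inter> filter_join F G = F" using filter_join_upper(1) by blast
  show "filter_join F G = filter_join G F" by (simp add: filter_join_def insert_commute)
qed (use assms in auto)


section \<open>Prime filters\<close>

text \<open>
  If \<open>x \<squnion> y \<in> F\<close>, this writes \<open>F\<close> as the meet of two larger filters of which one contains \<open>x\<close> and
  the other contains \<open>y\<close>. This is how meet-irreducibility, and later maximality, turns into the
  elementwise form of primeness.
\<close>

lemma filter_generated_insert_Int_colon:
  assumes F: "rl_filter F"
  shows "filter_generated (insert x F) \<inter> {b. sup x b \<in> F} = F"
proof
  show "filter_generated (insert x F) \<inter> {b. sup x b \<in> F} \<subseteq> F"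
  proof
    fix b assume b: "b \<in> filter_generated (insert x F) \<inter> {b. sup x b \<in> F}"
    have "filter_generated (insert x F) \<subseteq> {c. sup b c \<in> F}"
      using b rl_filter_sup[OF F]
      by (subst filter_generated_least[OF rl_filter_colon[OF F]]) (auto simp: sup_commute)
    then show "b \<in> F" using b by auto
  qed
  show "F \<subseteq> filter_generated (insert x F) \<inter> {b. sup x b \<in> F}"
    using rl_filter_sup[OF F] filter_generated_upper[of "insert x F"]
    by (auto simp: sup_commute)
qed

lemma prime_filter_iff:
  "prime_filter P \<longleftrightarrow> rl_filter P \<and> P \<noteq> UNIV \<and> (\<forall>x y. sup x y \<in> P \<longrightarrow> x \<in> P \<or> y \<in> P)"
proof (intro iffI conjI allI impI)
  assume P: "prime_filter P"
  then show F: "rl_filter P" and "P \<noteq> UNIV" by (simp_all add: prime_filter_def)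
  fix x y assume "sup x y \<in> P"
  moreover have "P = filter_generated (insert x P) \<or> P = {b. sup x b \<in> P}"
    using P filter_generated_insert_Int_colon[OF F, of x] filter_generated_filter
      rl_filter_colon[OF F, of x]
    unfolding prime_filter_def by metis
  ultimately show "x \<in> P \<or> y \<in> P" using filter_generated_upper[of "insert x P"] by blast
next
  assume P: "rl_filter P \<and> P \<noteq> UNIV \<and> (\<forall>x y. sup x y \<in> P \<longrightarrow> x \<in> P \<or> y \<in> P)"
  have "P = F \<or> P = G" if F: "rl_filter F" and G: "rl_filter G" and PFG: "P = F \<inter> G" for F G
  proof (rule ccontr)
    assume "\<not> ?thesis"
    then obtain f g where fg: "f \<in> F" "f \<notin> P" "g \<in> G" "g \<notin> P" using PFG by blast
    have "sup f g \<in> P"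
      using rl_filter_sup[OF F fg(1), of g] rl_filter_sup[OF G fg(3), of f] PFG
      by (simp add: sup_commute)
    then show False using P fg by blast
  qed
  then show "prime_filter P" using P by (simp add: prime_filter_def)
qed

lemma prime_filter_rl_filter: "prime_filter P \<Longrightarrow> rl_filter P"
  by (simp add: prime_filter_def)

lemma prime_filter_sup: "prime_filter P \<Longrightarrow> sup x y \<in> P \<Longrightarrow> x \<in> P \<or> y \<in> P"
  by (simp add: prime_filter_iff)

lemma prime_filter_bot: "prime_filter P \<Longrightarrow> bot \<notin> P"
  using rl_filter_UNIV_iff by (auto simp: prime_filter_def)

text \<open>
  Prime separation: a filter maximal among those that contain \<open>F\<close> and miss \<open>S\<close> is prime, because
  both factors of the decomposition above would meet \<open>S\<close>, hence so would their intersection.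
\<close>

lemma prime_filter_separation:
  assumes F: "rl_filter F" and S: "S \<noteq> {}" "\<And>s t. s \<in> S \<Longrightarrow> t \<in> S \<Longrightarrow> sup s t \<in> S"
    and disj: "F \<inter> S = {}"
  shows "\<exists>P. prime_filter P \<and> F \<subseteq> P \<and> P \<inter> S = {}"
proof -
  let ?A = "{M. rl_filter M \<and> F \<subseteq> M \<and> M \<inter> S = {}}"
  have "\<Union>C \<in> ?A" if C: "C \<noteq> {}" "subset.chain ?A C" for C
  proof -
    have sub: "M \<in> ?A" if "M \<in> C" for M using C(2) that by (auto simp: subset.chain_def)
    have "x * y \<in> \<Union>C" if x: "x \<in> \<Union>C" and y: "y \<in> \<Union>C" for x y
    proof -
      obtain M N where MN: "M \<in> C" "x \<in> M" "N \<in> C" "y \<in> N" using x y by blast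
      then have "M \<subseteq> N \<or> N \<subseteq> M" using C(2) by (auto simp: subset_chain_def)
      then show ?thesis using MN sub rl_filter_mult by blast
    qed
    moreover have "sup x y \<in> \<Union>C" if "x \<in> \<Union>C" for x y
      using that sub rl_filter_sup by blast
    moreover have "F \<subseteq> \<Union>C" "\<Union>C \<inter> S = {}" using C(1) sub by blast+
    moreover have "\<Union>C \<noteq> {}" using calculation(3) F unfolding rl_filter_def by blast
    ultimately show ?thesis unfolding rl_filter_def by blast
  qed
  moreover have "?A \<noteq> {}" using F disj by blast
  ultimately have "\<exists>M\<in>?A. \<forall>N\<in>?A. M \<subseteq> N \<longrightarrow> N = M"
    by (intro subset_Zorn_nonempty)
  then obtain M where "M \<in> ?A" and max: "\<And>N. N \<in> ?A \<Longrightarrow> M \<subseteq> N \<Longrightarrow> N = M"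
    by (elim bexE) simp
  then have M: "rl_filter M" "F \<subseteq> M" "M \<inter> S = {}" by auto
  have meets: "N \<inter> S \<noteq> {}" if "rl_filter N" "M \<subseteq> N" "z \<in> N" "z \<notin> M" for N z
    using max[of N] that M(2) by blast
  have "x \<in> M \<or> y \<in> M" if xy: "sup x y \<in> M" for x y
  proof (rule ccontr)
    assume not: "\<not> ?thesis"
    let ?G = "filter_generated (insert x M)" and ?H = "{b. sup x b \<in> M}"
    note GH = filter_generated_insert_Int_colon[OF M(1), of x]
    have G: "rl_filter ?G" and H: "rl_filter ?H"
      using filter_generated_filter rl_filter_colon[OF M(1)] by auto
    have "?G \<inter> S \<noteq> {}"
      using meets[OF G, of x] not filter_generated_upper[of "insert x M"] by blast
    moreover have "?H \<inter> S \<noteq> {}" using meets[OF H, of y] not xy GH by blast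
    ultimately obtain s t where st: "s \<in> ?G" "s \<in> S" "t \<in> ?H" "t \<in> S" by blast
    have "sup s t \<in> ?G \<inter> ?H"
      using rl_filter_sup[OF G st(1), of t] rl_filter_sup[OF H st(3), of s]
      by (simp only: sup_commute[of t s] Int_iff)
    then show False using GH S(2)[OF st(2,4)] M(3) by blast
  qed
  then have "prime_filter M" unfolding prime_filter_iff using M S(1) by blast
  then show ?thesis using M by blast
qed

text \<open>
  The Zorn argument runs downwards, so it is applied to complements of prime filters.
\<close>

lemma minimal_prime_filter_below:
  assumes P: "prime_filter P"
  shows "\<exists>M. minimal_prime_filter M \<and> M \<subseteq> P"
proof -
  let ?A = "{X. prime_filter (- X) \<and> - X \<subseteq> P}"
  have "\<Union>C \<in> ?A" if C: "C \<noteq> {}" "subset.chain ?A C" for C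
  proof -
    have sub: "prime_filter (- X)" "- X \<subseteq> P" if "X \<in> C" for X
      using C(2) that by (auto simp: subset.chain_def)
    have "rl_filter (\<Inter>(uminus ` C))"
      by (rule rl_filter_Inter) (use sub prime_filter_rl_filter in blast)
    moreover have le: "\<Inter>(uminus ` C) \<subseteq> P" and "\<Inter>(uminus ` C) \<noteq> UNIV"
      using C(1) sub prime_filter_bot by blast+
    moreover have "x \<in> \<Inter>(uminus ` C) \<or> y \<in> \<Inter>(uminus ` C)"
      if xy: "sup x y \<in> \<Inter>(uminus ` C)" for x y
    proof (rule ccontr)
      assume "\<not> ?thesis"
      then obtain X Y where XY: "X \<in> C" "x \<in> X" "Y \<in> C" "y \<in> Y" by blast
      then have "X \<subseteq> Y \<or> Y \<subseteq> X" using C(2) by (auto simp: subset_chain_def)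
      then obtain Z where Z: "Z \<in> C" "x \<in> Z" "y \<in> Z" using XY by blast
      then show False using prime_filter_sup[OF sub(1)[OF Z(1)], of x y] xy by blast
    qed
    ultimately have "prime_filter (\<Inter>(uminus ` C))" unfolding prime_filter_iff by blast
    then show ?thesis using le by (simp add: uminus_Sup)
  qed
  moreover have "?A \<noteq> {}" using P by (auto intro: exI[of _ "- P"])
  ultimately have "\<exists>X\<in>?A. \<forall>Y\<in>?A. X \<subseteq> Y \<longrightarrow> Y = X"
    by (intro subset_Zorn_nonempty)
  then obtain X where X: "X \<in> ?A" and max: "\<And>Y. Y \<in> ?A \<Longrightarrow> X \<subseteq> Y \<Longrightarrow> Y = X"
    by (elim bexE) simp
  have "Q = - X" if "prime_filter Q" "Q \<subseteq> - X" for Q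
    using max[of "- Q"] that X by auto
  then show ?thesis using X unfolding minimal_prime_filter_def by blast
qed


section \<open>Coannihilators\<close>

lemma coannihilator_eq_omega: "coannihilator x = omega {..x}"
proof -
  have "sup a x = 1" if "y \<le> x" "sup a y = 1" for a y
    using sup_mono[OF order_refl that(1), of a] that(2) by (simp add: antisym rl_le_one)
  then show ?thesis by (auto simp: coannihilator_def omega_def)
qed

lemma lattice_ideal_atMost: "lattice_ideal {..x}"
  unfolding lattice_ideal_def by (auto intro: order_trans)

lemma coannihilator_in_Omega: "coannihilator x \<in> Omega"
  unfolding Omega_def using coannihilator_eq_omega lattice_ideal_atMost by blast

lemma Omega_filter: "F \<in> Omega \<Longrightarrow> rl_filter F"
  by (auto simp: Omega_def omega_filter)

lemma coannihilator_filter: "rl_filter (coannihilator x)"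
  by (simp add: coannihilator_eq_omega omega_filter lattice_ideal_atMost)

lemma coannihilator_mono: "x \<le> y \<Longrightarrow> coannihilator x \<subseteq> coannihilator y"
  unfolding coannihilator_eq_omega omega_def by (auto intro: order_trans)

lemma coannihilator_bot: "coannihilator bot = {1}"
  by (simp add: coannihilator_def)

lemma coannihilator_subset_omega: "x \<in> I \<Longrightarrow> coannihilator x \<subseteq> omega I"
  by (auto simp: coannihilator_def omega_def)

text \<open>
  The product takes the place of the lattice meet: even when the lattice of elements is not
  distributive, \<open>a \<squnion> x = 1\<close> and \<open>a \<squnion> y = 1\<close> give \<open>a \<squnion> (x * y) = 1\<close>.
\<close>

lemma coannihilator_Int: "coannihilator x \<inter> coannihilator y = coannihilator (x * y)"
proof
  show "coannihilator x \<inter> coannihilator y \<subseteq> coannihilator (x * y)"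
    using rl_sup_mult_one[of x _ y] by (auto simp: coannihilator_def sup_commute)
  show "coannihilator (x * y) \<subseteq> coannihilator x \<inter> coannihilator y"
    using coannihilator_mono[OF rl_mult_le_left[of x y]]
      coannihilator_mono[OF rl_mult_le_left[of y x]]
    by (simp add: mult.commute)
qed

lemma Omega_Int:
  assumes F: "F \<in> Omega" and G: "G \<in> Omega"
  shows "F \<inter> G \<in> Omega"
proof -
  obtain I J where I: "lattice_ideal I" "F = omega I" and J: "lattice_ideal J" "G = omega J"
    using F G by (auto simp: Omega_def)
  have prod: "x * y \<in> I \<inter> J" if "x \<in> I" "y \<in> J" for x y
    using that I(1) J(1) rl_mult_le_left[of x y] rl_mult_le_left[of y x]
    unfolding lattice_ideal_def by (metis IntI mult.commute)
  have "omega I \<inter> omega J \<subseteq> omega (I \<inter> J)"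
  proof
    fix a assume "a \<in> omega I \<inter> omega J"
    then obtain x y where "x \<in> I" "y \<in> J" "a \<in> coannihilator x \<inter> coannihilator y"
      by (auto simp: omega_def coannihilator_def)
    then show "a \<in> omega (I \<inter> J)"
      using coannihilator_Int coannihilator_subset_omega[OF prod] by blast
  qed
  moreover have "omega (I \<inter> J) \<subseteq> omega I \<inter> omega J" by (auto simp: omega_def)
  moreover have "lattice_ideal (I \<inter> J)"
  proof -
    obtain i j where "i \<in> I" "j \<in> J" using I(1) J(1) by (auto simp: lattice_ideal_def)
    then have "I \<inter> J \<noteq> {}" using prod by blast
    then show ?thesis using I(1) J(1) unfolding lattice_ideal_def by (intro conjI) (assumption | fast)+
  qed
  ultimately show ?thesis using I(2) J(2) unfolding Omega_def by blast
qed


section \<open>Comaximal coannihilators\<close>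

definition comaximal_coannihilators :: "'a::residuated_lattice itself \<Rightarrow> bool" where
  "comaximal_coannihilators _ \<longleftrightarrow>
     (\<forall>x y :: 'a. sup x y = 1 \<longrightarrow> filter_join (coannihilator x) (coannihilator y) = UNIV)"

text \<open>
  Writing the join as \<open>\<omega>(I)\<close>, there is \<open>k \<in> I\<close> with \<open>x \<squnion> k = y \<squnion> k = 1\<close>, since \<open>x \<in> y\<^sup>\<bottom>\<close> and
  \<open>y \<in> x\<^sup>\<bottom>\<close>. So \<open>k\<close> itself lies in \<open>x\<^sup>\<bottom> \<subseteq> \<omega>(I)\<close>; it is joined to \<open>1\<close> by an element of \<open>I\<close>,
  which forces \<open>1 \<in> I\<close>.
\<close>

lemma filter_join_coannihilator_UNIV_if_Omega:
  fixes x y :: "'a::residuated_lattice"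
  assumes xy: "sup x y = 1" and Om: "filter_join (coannihilator x) (coannihilator y) \<in> Omega"
  shows "filter_join (coannihilator x) (coannihilator y) = UNIV"
proof -
  obtain I where I: "lattice_ideal I"
    and eq: "filter_join (coannihilator x) (coannihilator y) = omega I"
    using Om by (auto simp: Omega_def)
  have sub: "coannihilator x \<subseteq> omega I" "coannihilator y \<subseteq> omega I"
    using filter_join_upper[where F = "coannihilator x" and G = "coannihilator y"] eq by auto
  have "y \<in> omega I"
    using sub xy by (auto simp: coannihilator_def sup_commute)
  then obtain k where k: "k \<in> I" "sup y k = 1" by (auto simp: omega_def)
  have "x \<in> omega I" using sub xy by (auto simp: coannihilator_def)
  then obtain j where j: "j \<in> I" "sup x j = 1" by (auto simp: omega_def)
  have "sup (sup k j) x = 1"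
    using j(2) by (metis one_eq_top sup_assoc sup_commute sup_top_right)
  then have "sup k j \<in> omega I" using sub by (auto simp: coannihilator_def)
  then obtain l where l: "l \<in> I" "sup (sup k j) l = 1" by (auto simp: omega_def)
  have "sup (sup k j) l \<in> I" using I k(1) j(1) l(1) by (simp add: lattice_ideal_def)
  then have "bot \<in> omega I" using l(2) by (auto simp: omega_def)
  then show ?thesis using eq rl_filter_UNIV_iff[OF omega_filter[OF I]] by simp
qed

text \<open>
  For \<open>a \<in> (x \<squnion> y)\<^sup>\<bottom>\<close> the hypothesis applies to the pair \<open>a \<squnion> x\<close>, \<open>y\<close>. Joining with \<open>a\<close> maps
  both \<open>(a \<squnion> x)\<^sup>\<bottom>\<close> and \<open>y\<^sup>\<bottom>\<close> into \<open>x\<^sup>\<bottom> \<veebar> y\<^sup>\<bottom>\<close>, hence the whole algebra, and in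
  particular \<open>a = a \<squnion> 0\<close> lies there.
\<close>

lemma filter_join_coannihilator:
  fixes x y :: "'a::residuated_lattice"
  assumes "comaximal_coannihilators TYPE('a)"
  shows "filter_join (coannihilator x) (coannihilator y) = coannihilator (sup x y)" (is "?J = _")
proof
  show "?J \<subseteq> coannihilator (sup x y)"
    by (simp add: filter_join_subset_iff coannihilator_filter coannihilator_mono)
  show "coannihilator (sup x y) \<subseteq> ?J"
  proof
    fix a assume "a \<in> coannihilator (sup x y)"
    then have "sup (sup a x) y = 1" by (simp add: coannihilator_def sup_assoc)
    then have univ: "filter_join (coannihilator (sup a x)) (coannihilator y) = UNIV"
      using assms by (simp add: comaximal_coannihilators_def)
    have "coannihilator (sup a x) \<subseteq> {b. sup a b \<in> coannihilator x}"
      by (auto simp: coannihilator_def ac_simps)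
    moreover have "coannihilator y \<subseteq> {b. sup a b \<in> coannihilator y}"
      using rl_filter_sup[OF coannihilator_filter] by (auto simp: sup_commute)
    ultimately have "filter_join (coannihilator (sup a x)) (coannihilator y) \<subseteq> {b. sup a b \<in> ?J}"
      using filter_join_upper[where F = "coannihilator x" and G = "coannihilator y"]
      by (subst filter_join_subset_iff[OF rl_filter_colon[OF filter_join_filter]]) blast
    then have "bot \<in> {b. sup a b \<in> ?J}" using univ by blast
    then show "a \<in> ?J" by simp
  qed
qed

text \<open>
  The representing ideal is the largest possible one, all \<open>z\<close> with \<open>z\<^sup>\<bottom>\<close> inside the join. This
  avoids describing the ideal generated by a union of ideals.
\<close>

lemma filter_Join_in_Omega:
  fixes \<F> :: "'a::residuated_lattice set set"
  assumes C: "comaximal_coannihilators TYPE('a)" and \<F>: "\<F> \<subseteq> Omega"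
  shows "filter_Join \<F> \<in> Omega"
proof -
  let ?K = "{z. coannihilator z \<subseteq> filter_Join \<F>}"
  have "bot \<in> ?K" using rl_filter_one[OF filter_Join_filter] by (simp add: coannihilator_bot)
  moreover have "y \<in> ?K" if "x \<in> ?K" "y \<le> x" for x y
    using that coannihilator_mono by blast
  moreover have "sup x y \<in> ?K" if "x \<in> ?K" "y \<in> ?K" for x y
    using that by (simp add: filter_join_coannihilator[OF C, symmetric]
        filter_join_subset_iff filter_Join_filter)
  ultimately have K: "lattice_ideal ?K" unfolding lattice_ideal_def by blast
  have "F \<subseteq> omega ?K" if F: "F \<in> \<F>" for F
  proof -
    obtain I where I: "F = omega I" using F \<F> by (auto simp: Omega_def)
    have "I \<subseteq> ?K" using coannihilator_subset_omega filter_Join_upper[OF F] I by blast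
    then show ?thesis using I by (auto simp: omega_def)
  qed
  then have "filter_Join \<F> \<subseteq> omega ?K" by (simp add: filter_Join_subset_iff omega_filter[OF K])
  moreover have "omega ?K \<subseteq> filter_Join \<F>" by (auto simp: omega_def coannihilator_def)
  ultimately show ?thesis using K by (auto simp: Omega_def)
qed


section \<open>Coannihilators and minimal prime filters\<close>

text \<open>
  The complement of \<open>P\<close> is closed under joins, and it remains so after adjoining all \<open>x \<squnion> s\<close> with
  \<open>s \<notin> P\<close>; the hypothesis keeps \<open>1\<close> out of the enlarged set. A prime filter missing that set is
  contained in \<open>P\<close> and omits \<open>x\<close>.
\<close>

lemma prime_filter_below_omitting:
  assumes P: "prime_filter P" and sub: "coannihilator x \<subseteq> P"
  shows "\<exists>Q. prime_filter Q \<and> Q \<subseteq> P \<and> x \<notin> Q"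
proof -
  let ?S = "- P \<union> sup x ` (- P)"
  have bot: "bot \<in> - P" using prime_filter_bot[OF P] by simp
  have cl: "sup s t \<in> - P" if "s \<in> - P" "t \<in> - P" for s t
    using that prime_filter_sup[OF P] by blast
  have "sup s t \<in> ?S" if st: "s \<in> ?S" "t \<in> ?S" for s t
  proof -
    have repr: "\<exists>u'\<in>- P. u = u' \<or> u = sup x u'" if "u \<in> ?S" for u
      using that by (elim UnE imageE) blast+
    then obtain s' t' where "s' \<in> - P" "s = s' \<or> s = sup x s'"
      and "t' \<in> - P" "t = t' \<or> t = sup x t'"
      using repr[OF st(1)] repr[OF st(2)] by blast
    then have "sup s' t' \<in> - P" "sup s t = sup s' t' \<or> sup s t = sup x (sup s' t')"
      using cl by (auto simp: ac_simps)
    then show ?thesis by (metis UnI1 UnI2 imageI)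
  qed
  moreover have "1 \<notin> ?S"
  proof -
    have "sup x s \<noteq> 1" if "s \<in> - P" for s
      using sub that by (auto simp: coannihilator_def sup_commute)
    then show ?thesis using rl_filter_one[OF prime_filter_rl_filter[OF P]] by force
  qed
  moreover have "rl_filter {1 :: 'a}"
    by (simp add: coannihilator_bot[symmetric] coannihilator_filter)
  ultimately obtain Q where Q: "prime_filter Q" "Q \<inter> ?S = {}"
    using prime_filter_separation[of "{1}" ?S] bot by blast
  have "x \<in> ?S" using bot by (metis UnI2 imageI sup_bot_right)
  then show ?thesis using Q by blast
qed

lemma coannihilator_subset_prime: "prime_filter P \<Longrightarrow> x \<notin> P \<Longrightarrow> coannihilator x \<subseteq> P"
  using prime_filter_sup[of P _ x] rl_filter_one[OF prime_filter_rl_filter, of P]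
  by (auto simp: coannihilator_def)

lemma minimal_prime_filter_prime: "minimal_prime_filter M \<Longrightarrow> prime_filter M"
  by (simp add: minimal_prime_filter_def)

lemma minimal_prime_filter_witness:
  assumes M: "minimal_prime_filter M" and x: "x \<in> M"
  shows "\<exists>y. y \<notin> M \<and> sup x y = 1"
proof -
  have "\<not> coannihilator x \<subseteq> M"
    using prime_filter_below_omitting[of M x] M x unfolding minimal_prime_filter_def by blast
  then show ?thesis by (auto simp: coannihilator_def sup_commute)
qed

lemma is_mp_if_comaximal:
  assumes C: "comaximal_coannihilators TYPE('a::residuated_lattice)"
  shows "is_mp TYPE('a)"
  unfolding is_mp_def
proof (intro allI impI)
  fix P :: "'a set" assume P: "prime_filter P"
  have le: "M \<subseteq> N" if M: "minimal_prime_filter M" "M \<subseteq> P" and N: "minimal_prime_filter N" "N \<subseteq> P"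
    for M N
  proof
    fix x assume x: "x \<in> M"
    show "x \<in> N"
    proof (rule ccontr)
      assume "x \<notin> N"
      then have "coannihilator x \<subseteq> P"
        using coannihilator_subset_prime[OF minimal_prime_filter_prime[OF N(1)]] N(2) by blast
      moreover obtain y where y: "y \<notin> M" "sup x y = 1"
        using minimal_prime_filter_witness[OF M(1) x] by blast
      then have "coannihilator y \<subseteq> P"
        using coannihilator_subset_prime[OF minimal_prime_filter_prime[OF M(1)]] M(2) by blast
      ultimately have "filter_join (coannihilator x) (coannihilator y) \<subseteq> P"
        using prime_filter_rl_filter[OF P] by (simp add: filter_join_subset_iff)
      then show False
        using C y(2) prime_filter_bot[OF P] by (auto simp: comaximal_coannihilators_def)
    qed
  qed
  obtain M where "minimal_prime_filter M \<and> M \<subseteq> P" using minimal_prime_filter_below[OF P] by blast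
  then show "\<exists>!M. minimal_prime_filter M \<and> M \<subseteq> P"
    by (rule ex1I) (use \<open>minimal_prime_filter M \<and> M \<subseteq> P\<close> le in blast)
qed

lemma comaximal_if_is_mp:
  assumes mp: "is_mp TYPE('a::residuated_lattice)"
  shows "comaximal_coannihilators TYPE('a)"
  unfolding comaximal_coannihilators_def
proof (intro allI impI, rule ccontr)
  fix x y :: 'a
  let ?J = "filter_join (coannihilator x) (coannihilator y)"
  assume xy: "sup x y = 1" and "?J \<noteq> UNIV"
  then have "?J \<inter> {bot} = {}" using rl_filter_UNIV_iff[OF filter_join_filter] by blast
  then obtain P where P: "prime_filter P" "?J \<subseteq> P"
    using prime_filter_separation[OF filter_join_filter, of "{bot}"] by (metis insert_not_empty singletonD singletonI sup.idem)
  have omit: "\<exists>M. minimal_prime_filter M \<and> M \<subseteq> P \<and> z \<notin> M" if "coannihilator z \<subseteq> P" for z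
    using prime_filter_below_omitting[OF P(1) that] minimal_prime_filter_below by blast
  have sub: "coannihilator x \<subseteq> P" "coannihilator y \<subseteq> P" using P(2) filter_join_upper by blast+
  obtain M where M: "minimal_prime_filter M" "M \<subseteq> P" "x \<notin> M" using omit[OF sub(1)] by blast
  obtain N where N: "minimal_prime_filter N" "N \<subseteq> P" "y \<notin> N" using omit[OF sub(2)] by blast
  have "\<exists>!M. minimal_prime_filter M \<and> M \<subseteq> P" using mp P(1) by (simp add: is_mp_def)
  then have "M = N" using M(1,2) N(1,2) by blast
  moreover have prime: "prime_filter M" using M(1) by (rule minimal_prime_filter_prime)
  moreover have "sup x y \<in> M" using xy rl_filter_one[OF prime_filter_rl_filter[OF prime]] by simp
  ultimately show False using prime_filter_sup M(3) N(3) by blast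
qed


section \<open>The equivalence\<close>

lemma omega_join_condition_iff_comaximal:
  "(\<forall>F \<in> (Omega :: 'a::residuated_lattice set set). \<forall>G \<in> Omega.
      omega_join F G = UNIV \<longrightarrow> filter_join F G = UNIV)
    \<longleftrightarrow> comaximal_coannihilators TYPE('a)"
proof -
  have key: "omega_join (omega I) (omega J) = UNIV \<longleftrightarrow> (\<exists>x\<in>I. \<exists>y\<in>J. sup x y = 1)"
    if I: "lattice_ideal I" and J: "lattice_ideal J" for I J :: "'a set"
  proof -
    have eq: "omega_join (omega I) (omega J) = {a. \<exists>x\<in>I. \<exists>y\<in>J. sup (sup a x) y = 1}"
      using I J by (simp add: omega_join_omega omega_ideal_join)
    have "bot \<in> omega_join (omega I) (omega J) \<longleftrightarrow> (\<exists>x\<in>I. \<exists>y\<in>J. sup x y = 1)"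
      by (simp add: eq)
    moreover have "sup (sup a x) y = 1" if "sup x y = 1" for a x y :: 'a
      using that by (simp add: sup_assoc one_eq_top)
    then have "omega_join (omega I) (omega J) = UNIV" if "\<exists>x\<in>I. \<exists>y\<in>J. sup x y = 1"
      using that unfolding eq by blast
    ultimately show ?thesis by blast
  qed
  show ?thesis
  proof
    assume 1: "\<forall>F \<in> (Omega :: 'a set set). \<forall>G \<in> Omega.
      omega_join F G = UNIV \<longrightarrow> filter_join F G = UNIV"
    show "comaximal_coannihilators TYPE('a)"
      unfolding comaximal_coannihilators_def
    proof (intro allI impI)
      fix x y :: 'a assume xy: "sup x y = 1"
      have "omega_join (coannihilator x) (coannihilator y) = UNIV"
        unfolding coannihilator_eq_omega key[OF lattice_ideal_atMost lattice_ideal_atMost]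
        using xy by blast
      then show "filter_join (coannihilator x) (coannihilator y) = UNIV"
        using 1 coannihilator_in_Omega by blast
    qed
  next
    assume C: "comaximal_coannihilators TYPE('a)"
    show "\<forall>F \<in> (Omega :: 'a set set). \<forall>G \<in> Omega.
      omega_join F G = UNIV \<longrightarrow> filter_join F G = UNIV"
    proof (intro ballI impI)
      fix F G :: "'a set" assume "F \<in> Omega" "G \<in> Omega" and univ: "omega_join F G = UNIV"
      then obtain I J where I: "lattice_ideal I" "F = omega I" and J: "lattice_ideal J" "G = omega J"
        by (auto simp: Omega_def)
      then obtain x y where xy: "x \<in> I" "y \<in> J" "sup x y = 1" using key univ by blast
      have "filter_join (coannihilator x) (coannihilator y) \<subseteq> filter_join F G"
        using coannihilator_subset_omega[OF xy(1)] coannihilator_subset_omega[OF xy(2)] I(2) J(2)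
          filter_join_upper[where F = F and G = G]
        by (auto simp: filter_join_subset_iff filter_join_filter)
      then show "filter_join F G = UNIV" using C xy(3) by (auto simp: comaximal_coannihilators_def)
    qed
  qed
qed

lemma Join_closed_iff_comaximal:
  "(\<forall>\<F> \<subseteq> (Omega :: 'a::residuated_lattice set set). filter_Join \<F> \<in> Omega)
    \<longleftrightarrow> comaximal_coannihilators TYPE('a)"
proof
  assume 3: "\<forall>\<F> \<subseteq> (Omega :: 'a set set). filter_Join \<F> \<in> Omega"
  have "filter_join (coannihilator x) (coannihilator y) \<in> Omega" for x y :: 'a
    using 3 by (simp add: filter_join_def coannihilator_in_Omega)
  then show "comaximal_coannihilators TYPE('a)"
    unfolding comaximal_coannihilators_def
    using filter_join_coannihilator_UNIV_if_Omega by blast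
qed (use filter_Join_in_Omega in blast)

lemma frame_iff_Join_closed:
  "frame_on (Omega :: 'a::residuated_lattice set set) (\<inter>) filter_Join
    \<longleftrightarrow> (\<forall>\<F> \<subseteq> (Omega :: 'a set set). filter_Join \<F> \<in> Omega)"
proof
  assume "frame_on (Omega :: 'a set set) (\<inter>) filter_Join"
  then show "\<forall>\<F> \<subseteq> (Omega :: 'a set set). filter_Join \<F> \<in> Omega"
    using frame_on.Join_closed by blast
next
  assume 3: "\<forall>\<F> \<subseteq> (Omega :: 'a set set). filter_Join \<F> \<in> Omega"
  have "lattice_on (Omega :: 'a set set) (\<inter>) filter_join"
    by (rule lattice_on_filters) (use 3 Omega_filter Omega_Int in \<open>auto simp: filter_join_def\<close>)
  then have "lattice_on (Omega :: 'a set set) (\<inter>) (\<lambda>F G. filter_Join {F, G})"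
    by (simp add: filter_join_def[abs_def])
  moreover have "frame_on_axioms (Omega :: 'a set set) (\<inter>) filter_Join"
  proof
    fix \<F> :: "'a set set" and F assume \<F>: "\<F> \<subseteq> Omega"
    show "filter_Join \<F> \<in> Omega" using 3 \<F> by blast
    show "F \<inter> filter_Join \<F> = F" if "F \<in> \<F>" using filter_Join_upper[OF that] by blast
    show "filter_Join \<F> \<inter> F = filter_Join \<F>"
      if "F \<in> Omega" "\<And>G. G \<in> \<F> \<Longrightarrow> G \<inter> F = G"
      using filter_Join_subset_iff[OF Omega_filter[OF that(1)], of \<F>] that(2) by blast
    show "F \<inter> filter_Join \<F> = filter_Join {F \<inter> G | G. G \<in> \<F>}" if "F \<in> Omega"
      using filter_Join_distrib[OF Omega_filter[OF that]] \<F> Omega_filter by blast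
  qed
  ultimately show "frame_on (Omega :: 'a set set) (\<inter>) filter_Join" by (rule frame_on.intro)
qed

lemma gamma_lattice_iff_comaximal:
  "lattice_on (gamma :: 'a::residuated_lattice set set) (\<inter>) filter_join
    \<longleftrightarrow> comaximal_coannihilators TYPE('a)"
proof
  assume "lattice_on (gamma :: 'a set set) (\<inter>) filter_join"
  then have "filter_join (coannihilator x) (coannihilator y) \<in> gamma" for x y :: 'a
    by (rule lattice_on.join_closed) (simp_all add: gamma_def)
  then have "filter_join (coannihilator x) (coannihilator y) \<in> Omega" for x y :: 'a
    using coannihilator_in_Omega unfolding gamma_def by (metis imageE)
  then show "comaximal_coannihilators TYPE('a)"
    unfolding comaximal_coannihilators_def
    using filter_join_coannihilator_UNIV_if_Omega by blast
next
  assume C: "comaximal_coannihilators TYPE('a)"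
  show "lattice_on (gamma :: 'a set set) (\<inter>) filter_join"
    by (rule lattice_on_filters)
      (auto simp: gamma_def coannihilator_filter coannihilator_Int filter_join_coannihilator[OF C])
qed

theorem theorem3p6:
  shows "((\<forall>F \<in> (Omega :: 'a::residuated_lattice set set). \<forall>G \<in> Omega.
             omega_join F G = UNIV \<longrightarrow> filter_join F G = UNIV)
           \<longleftrightarrow> is_mp TYPE('a))
       \<and> (is_mp TYPE('a)
           \<longleftrightarrow> (\<forall>\<F> \<subseteq> (Omega :: 'a set set). filter_Join \<F> \<in> Omega))
       \<and> ((\<forall>\<F> \<subseteq> (Omega :: 'a set set). filter_Join \<F> \<in> Omega)
           \<longleftrightarrow> frame_on (Omega :: 'a set set) (\<inter>) filter_Join)
       \<and> (frame_on (Omega :: 'a set set) (\<inter>) filter_Join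
           \<longleftrightarrow> lattice_on (gamma :: 'a set set) (\<inter>) filter_join)"
  using is_mp_if_comaximal comaximal_if_is_mp
  unfolding omega_join_condition_iff_comaximal frame_iff_Join_closed Join_closed_iff_comaximal
    gamma_lattice_iff_comaximal
  by blast

end
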